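(* Let $(\mathcal{C},\Omega,\mathfrak{P})$ be a spined category, let $S$ be a set and $f:S\to\mathrm{Ob}(\mathcal{C})$ a function such that (1) for every $n\in\mathbb{N}$ there is $X\in S$ with $f(X)=\Omega_n$, and (2) for every span $f(X)\xleftarrow{x}\Omega_n\xrightarrow{y}f(Y)$ in $\mathcal{C}$ there is a distinguished element $Z_{x,y}\in S$ with $f(Z_{x,y})=\mathfrak{P}(x,y)$. Then there exist a sequence of objects $\Omega^S$ and a proxy pushout operation $\mathfrak{P}^S$ on $S_{\downarrow f}$ such that: $(S_{\downarrow f},\Omega^S,\mathfrak{P}^S)$ is a spined category; $f$ (acting as the identity on morphisms) is a spinal functor $(S_{\downarrow f},\Omega^S,\mathfrak{P}^S)\to(\mathcal{C},\Omega,\mathfrak{P})$; and if $(\mathcal{C},\Omega,\mathfrak{P})$ is measurable then so is $(S_{\downarrow f},\Omega^S,\mathfrak{P}^S)$.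
   Context: $S_{\downarrow f}$ is the category with object set $S$ and $\mathrm{Hom}_{S_{\downarrow f}}(A,B)=\mathrm{Hom}_{\mathcal{C}}(f(A),f(B))$, with composition and identities from $\mathcal{C}$. A spined category is a triple $(\mathcal{C},\Omega,\mathfrak{P})$: a category, a sequence of objects $(\Omega_n)_{n\in\mathbb{N}}$, and an operation $\mathfrak{P}$ assigning to each span $G\xleftarrow{g}\Omega_n\xrightarrow{h}H$ an object $\mathfrak{P}(g,h)$ and morphisms $\mathfrak{P}(g,h)_g:G\to\mathfrak{P}(g,h)$, $\mathfrak{P}(g,h)_h:H\to\mathfrak{P}(g,h)$ with $\mathfrak{P}(g,h)_gg=\mathfrak{P}(g,h)_hh$, such that (SC1) every object has a morphism to some $\Omega_n$; (SC2) for every such span and all $g':G\to G'$, $h':H\to H'$ there is a unique $(g',h'):\mathfrak{P}(g,h)\to\mathfrak{P}(g'g,h'h)$ with $(g',h')\mathfrak{P}(g,h)_g=\mathfrak{P}(g'g,h'h)_{g'g}g'$ and $(g',h')\mathfrak{P}(g,h)_h=\mathfrak{P}(g'g,h'h)_{h'h}h'$. A spinal functor $F:(\mathcal{C},\Omega^{\mathcal C},\mathfrak{P}^{\mathcal C})\to(\mathcal{D},\Omega^{\mathcal D},\mathfrak{P}^{\mathcal D})$ is a functor with $F(\Omega^{\mathcal C}_n)=\Omega^{\mathcal D}_n$ for all $n$ and, for every span, $F(\mathfrak{P}^{\mathcal C}(g,h))=\mathfrak{P}^{\mathcal D}(Fg,Fh)$, $F(\mathfrak{P}^{\mathcal C}(g,h)_g)=\mathfrak{P}^{\mathcal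 D}(Fg,Fh)_{Fg}$, $F(\mathfrak{P}^{\mathcal C}(g,h)_h)=\mathfrak{P}^{\mathcal D}(Fg,Fh)_{Fh}$. An S-functor is a spinal functor to the spined category $\mathbf{Nat}$ = the poset $(\mathbb{N},\le)$ with $\Omega_n=n$ and proxy pushouts given by maxima; a spined category is measurable if it admits an S-functor. *)

theory Defs
  imports Main
begin

text \<open>
  Hom-sets are not required to be disjoint, so a morphism does not determine its source and
  target. Composition, proxy pushouts and the morphism part of a functor therefore take the
  objects involved as explicit arguments; \<open>Comp C X Y Z k h\<close> is the composite \<open>k \<circ> h\<close>
  of \<open>h : X \<rightarrow> Y\<close> and \<open>k : Y \<rightarrow> Z\<close>.
\<close>

record ('o, 'm) cat =
  Obj :: "'o set"
  Hom :: "'o \<Rightarrow> 'o \<Rightarrow> 'm set"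
  Ident :: "'o \<Rightarrow> 'm"
  Comp :: "'o \<Rightarrow> 'o \<Rightarrow> 'o \<Rightarrow> 'm \<Rightarrow> 'm \<Rightarrow> 'm"

locale category =
  fixes C :: "('o, 'm) cat"
  assumes ident_in_hom: "X \<in> Obj C \<Longrightarrow> Ident C X \<in> Hom C X X"
    and comp_in_hom:
      "\<lbrakk>X \<in> Obj C; Y \<in> Obj C; Z \<in> Obj C; h \<in> Hom C X Y; k \<in> Hom C Y Z\<rbrakk>
        \<Longrightarrow> Comp C X Y Z k h \<in> Hom C X Z"
    and comp_ident_right:
      "\<lbrakk>X \<in> Obj C; Y \<in> Obj C; h \<in> Hom C X Y\<rbrakk> \<Longrightarrow> Comp C X X Y h (Ident C X) = h"
    and comp_ident_left:
      "\<lbrakk>X \<in> Obj C; Y \<in> Obj C; h \<in> Hom C X Y\<rbrakk> \<Longrightarrow> Comp C X Y Y (Ident C Y) h = h"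
    and comp_assoc:
      "\<lbrakk>W \<in> Obj C; X \<in> Obj C; Y \<in> Obj C; Z \<in> Obj C;
        h \<in> Hom C W X; k \<in> Hom C X Y; l \<in> Hom C Y Z\<rbrakk>
        \<Longrightarrow> Comp C W Y Z l (Comp C W X Y k h) = Comp C W X Z (Comp C X Y Z l k) h"

locale category_functor = dom: category C + cod: category D
  for C :: "('o, 'm) cat" and D :: "('p, 'n) cat" +
  fixes Fo :: "'o \<Rightarrow> 'p"
    and Fm :: "'o \<Rightarrow> 'o \<Rightarrow> 'm \<Rightarrow> 'n"
  assumes functor_obj: "X \<in> Obj C \<Longrightarrow> Fo X \<in> Obj D"
    and functor_hom:
      "\<lbrakk>X \<in> Obj C; Y \<in> Obj C; h \<in> Hom C X Y\<rbrakk> \<Longrightarrow> Fm X Y h \<in> Hom D (Fo X) (Fo Y)"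
    and functor_ident: "X \<in> Obj C \<Longrightarrow> Fm X X (Ident C X) = Ident D (Fo X)"
    and functor_comp:
      "\<lbrakk>X \<in> Obj C; Y \<in> Obj C; Z \<in> Obj C; h \<in> Hom C X Y; k \<in> Hom C Y Z\<rbrakk>
        \<Longrightarrow> Fm X Z (Comp C X Y Z k h) = Comp D (Fo X) (Fo Y) (Fo Z) (Fm Y Z k) (Fm X Y h)"

text \<open>
  For a span \<open>G \<leftarrow> A \<rightarrow> H\<close> with legs \<open>g\<close> and \<open>h\<close>, a proxy pushout operation
  \<open>P\<close> yields the object \<open>tip (P A G H g h)\<close> and the morphisms \<open>left_leg (P A G H g h)\<close>
  out of \<open>G\<close> and \<open>right_leg (P A G H g h)\<close> out of \<open>H\<close>. Its values on other
  arguments are irrelevant.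
\<close>

record ('o, 'm) proxy =
  tip :: 'o
  left_leg :: 'm
  right_leg :: 'm

type_synonym ('o, 'm) proxy_op = "'o \<Rightarrow> 'o \<Rightarrow> 'o \<Rightarrow> 'm \<Rightarrow> 'm \<Rightarrow> ('o, 'm) proxy"

definition spine_span ::
    "('o, 'm) cat \<Rightarrow> (nat \<Rightarrow> 'o) \<Rightarrow> nat \<Rightarrow> 'o \<Rightarrow> 'o \<Rightarrow> 'm \<Rightarrow> 'm \<Rightarrow> bool" where
  "spine_span C \<Omega> n G H g h \<longleftrightarrow>
     G \<in> Obj C \<and> H \<in> Obj C \<and> g \<in> Hom C (\<Omega> n) G \<and> h \<in> Hom C (\<Omega> n) H"

locale spined_category = category C
  for C :: "('o, 'm) cat" +
  fixes \<Omega> :: "nat \<Rightarrow> 'o"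
    and P :: "('o, 'm) proxy_op"
  assumes spine_obj: "\<Omega> n \<in> Obj C"
    and tip_obj: "spine_span C \<Omega> n G H g h \<Longrightarrow> tip (P (\<Omega> n) G H g h) \<in> Obj C"
    and left_leg_hom:
      "spine_span C \<Omega> n G H g h \<Longrightarrow>
        left_leg (P (\<Omega> n) G H g h) \<in> Hom C G (tip (P (\<Omega> n) G H g h))"
    and right_leg_hom:
      "spine_span C \<Omega> n G H g h \<Longrightarrow>
        right_leg (P (\<Omega> n) G H g h) \<in> Hom C H (tip (P (\<Omega> n) G H g h))"
    and proxy_commutes:
      "spine_span C \<Omega> n G H g h \<Longrightarrow>
        Comp C (\<Omega> n) G (tip (P (\<Omega> n) G H g h)) (left_leg (P (\<Omega> n) G H g h)) g
          = Comp C (\<Omega> n) H (tip (P (\<Omega> n) G H g h)) (right_leg (P (\<Omega> n) G H g h)) h"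
    and SC1: "X \<in> Obj C \<Longrightarrow> \<exists>n. Hom C X (\<Omega> n) \<noteq> {}"
    and SC2:
      "\<lbrakk>spine_span C \<Omega> n G H g h; G' \<in> Obj C; H' \<in> Obj C; g' \<in> Hom C G G'; h' \<in> Hom C H H'\<rbrakk>
        \<Longrightarrow> let p = P (\<Omega> n) G H g h;
                q = P (\<Omega> n) G' H' (Comp C (\<Omega> n) G G' g' g) (Comp C (\<Omega> n) H H' h' h)
            in \<exists>!u. u \<in> Hom C (tip p) (tip q) \<and>
                 Comp C G (tip p) (tip q) u (left_leg p)
                   = Comp C G G' (tip q) (left_leg q) g' \<and>
                 Comp C H (tip p) (tip q) u (right_leg p)
                   = Comp C H H' (tip q) (right_leg q) h'"

locale spinal_functor =
  dom: spined_category C \<Omega>C PC + cod: spined_category D \<Omega>D PD + category_functor C D Fo Fm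
  for C :: "('o, 'm) cat" and \<Omega>C PC
    and D :: "('p, 'n) cat" and \<Omega>D PD
    and Fo Fm +
  assumes functor_spine: "Fo (\<Omega>C n) = \<Omega>D n"
    and functor_tip:
      "spine_span C \<Omega>C n G H g h \<Longrightarrow>
        Fo (tip (PC (\<Omega>C n) G H g h))
          = tip (PD (\<Omega>D n) (Fo G) (Fo H) (Fm (\<Omega>C n) G g) (Fm (\<Omega>C n) H h))"
    and functor_left_leg:
      "spine_span C \<Omega>C n G H g h \<Longrightarrow>
        Fm G (tip (PC (\<Omega>C n) G H g h)) (left_leg (PC (\<Omega>C n) G H g h))
          = left_leg (PD (\<Omega>D n) (Fo G) (Fo H) (Fm (\<Omega>C n) G g) (Fm (\<Omega>C n) H h))"
    and functor_right_leg:
      "spine_span C \<Omega>C n G H g h \<Longrightarrow>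
        Fm H (tip (PC (\<Omega>C n) G H g h)) (right_leg (PC (\<Omega>C n) G H g h))
          = right_leg (PD (\<Omega>D n) (Fo G) (Fo H) (Fm (\<Omega>C n) G g) (Fm (\<Omega>C n) H h))"

definition Nat_cat :: "(nat, unit) cat" where
  "Nat_cat = \<lparr>Obj = UNIV, Hom = (\<lambda>a b. if a \<le> b then {()} else {}),
     Ident = (\<lambda>_. ()), Comp = (\<lambda>_ _ _ _ _. ())\<rparr>"

definition Nat_spine :: "nat \<Rightarrow> nat" where
  "Nat_spine n = n"

definition Nat_proxy :: "(nat, unit) proxy_op" where
  "Nat_proxy A G H g h = \<lparr>tip = max G H, left_leg = (), right_leg = ()\<rparr>"

lemma spined_category_Nat: "spined_category Nat_cat Nat_spine Nat_proxy"
  by unfold_locales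
    (auto simp: Nat_cat_def Nat_spine_def Nat_proxy_def spine_span_def Let_def split: if_splits)

definition S_functor ::
    "('o, 'm) cat \<Rightarrow> (nat \<Rightarrow> 'o) \<Rightarrow> ('o, 'm) proxy_op
      \<Rightarrow> ('o \<Rightarrow> nat) \<Rightarrow> ('o \<Rightarrow> 'o \<Rightarrow> 'm \<Rightarrow> unit) \<Rightarrow> bool" where
  "S_functor C \<Omega> P Fo Fm \<longleftrightarrow> spinal_functor C \<Omega> P Nat_cat Nat_spine Nat_proxy Fo Fm"

definition measurable :: "('o, 'm) cat \<Rightarrow> (nat \<Rightarrow> 'o) \<Rightarrow> ('o, 'm) proxy_op \<Rightarrow> bool" where
  "measurable C \<Omega> P \<longleftrightarrow> (\<exists>Fo Fm. S_functor C \<Omega> P Fo Fm)"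

definition pullback_cat :: "'s set \<Rightarrow> ('s \<Rightarrow> 'o) \<Rightarrow> ('o, 'm) cat \<Rightarrow> ('s, 'm) cat" where
  "pullback_cat S f C =
     \<lparr>Obj = S, Hom = (\<lambda>A B. Hom C (f A) (f B)),
      Ident = (\<lambda>A. Ident C (f A)), Comp = (\<lambda>A B D. Comp C (f A) (f B) (f D))\<rparr>"

end

theory Submission
  imports Defs
begin

text \<open>
  Hom-sets and composition of the pullback category are those of \<open>C\<close> between images under
  \<open>f\<close>, so any choice of preimages of the spine and of the proxy pushout tips, together with
  the legs taken from \<open>C\<close>, inherits all the axioms. An S-functor on \<open>C\<close> then restricts
  along \<open>f\<close> because spinal functors compose.
\<close>

lemma pullback_cat_simps [simp]:
  "Obj (pullback_cat S f C) = S"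
  "Hom (pullback_cat S f C) A B = Hom C (f A) (f B)"
  "Ident (pullback_cat S f C) A = Ident C (f A)"
  "Comp (pullback_cat S f C) A B D = Comp C (f A) (f B) (f D)"
  by (simp_all add: pullback_cat_def)

lemma category_pullback_cat:
  assumes "category C" and "f ` S \<subseteq> Obj C"
  shows "category (pullback_cat S f C)"
proof -
  interpret category C by fact
  have obj: "f A \<in> Obj C" if "A \<in> S" for A
    using assms(2) that by blast
  show ?thesis
    by unfold_locales
      (simp_all add: obj ident_in_hom comp_in_hom comp_ident_right comp_ident_left comp_assoc)
qed

lemma category_functor_pullback_cat:
  assumes "category C" and "f ` S \<subseteq> Obj C"
  shows "category_functor (pullback_cat S f C) C f (\<lambda>A B m. m)"
  using assms category_pullback_cat[OF assms]
  by (auto simp: category_functor_def category_functor_axioms_def)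

text \<open>Needed for \<open>SC2\<close>: the span of the second proxy pushout there is a composite
  one, and facts about its tip apply only once it is known to be a span.\<close>

lemma (in spined_category) spine_span_comp:
  assumes "spine_span C \<Omega> n G H g h" and "G' \<in> Obj C" and "H' \<in> Obj C"
    and "g' \<in> Hom C G G'" and "h' \<in> Hom C H H'"
  shows "spine_span C \<Omega> n G' H' (Comp C (\<Omega> n) G G' g' g) (Comp C (\<Omega> n) H H' h' h)"
  using assms by (auto simp: spine_span_def intro: comp_in_hom spine_obj)

text \<open>Since \<open>Fo\<close> carries spine to spine, a second spinal functor can be applied
  to the image span; this is what makes preservation of proxy pushouts stable under
  composition.\<close>

lemma (in spinal_functor) spine_span_image:
  assumes "spine_span C \<Omega>C n G H g h"
  shows "spine_span D \<Omega>D n (Fo G) (Fo H) (Fm (\<Omega>C n) G g) (Fm (\<Omega>C n) H h)"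
  using assms functor_obj functor_hom dom.spine_obj functor_spine
  unfolding spine_span_def by metis

lemma category_functor_comp:
  assumes "category_functor C D Fo Fm" and "category_functor D E Go Gm"
  shows "category_functor C E (\<lambda>X. Go (Fo X)) (\<lambda>X Y m. Gm (Fo X) (Fo Y) (Fm X Y m))"
proof -
  interpret F: category_functor C D Fo Fm by fact
  interpret G: category_functor D E Go Gm by fact
  show ?thesis
    by unfold_locales
      (simp_all add: F.functor_obj G.functor_obj F.functor_hom G.functor_hom
        F.functor_ident G.functor_ident F.functor_comp G.functor_comp)
qed

lemma spinal_functor_comp:
  assumes "spinal_functor C \<Omega>C PC D \<Omega>D PD Fo Fm"
    and "spinal_functor D \<Omega>D PD E \<Omega>E PE Go Gm"
  shows "spinal_functor C \<Omega>C PC E \<Omega>E PE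
    (\<lambda>X. Go (Fo X)) (\<lambda>X Y m. Gm (Fo X) (Fo Y) (Fm X Y m))"
proof -
  interpret F: spinal_functor C \<Omega>C PC D \<Omega>D PD Fo Fm by fact
  interpret G: spinal_functor D \<Omega>D PD E \<Omega>E PE Go Gm by fact
  interpret GF: category_functor C E
    "\<lambda>X. Go (Fo X)" "\<lambda>X Y m. Gm (Fo X) (Fo Y) (Fm X Y m)"
    using F.category_functor_axioms G.category_functor_axioms by (rule category_functor_comp)
  show ?thesis
    by unfold_locales
      (simp_all add: F.functor_spine G.functor_spine F.functor_tip F.functor_left_leg
        F.functor_right_leg G.functor_tip G.functor_left_leg G.functor_right_leg
        F.spine_span_image)
qed

lemma measurable_spinal_functor:
  assumes "spinal_functor C \<Omega>C PC D \<Omega>D PD Fo Fm" and "measurable D \<Omega>D PD"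
  shows "measurable C \<Omega>C PC"
  using assms spinal_functor_comp unfolding measurable_def S_functor_def by blast

definition pullback_proxy ::
    "('s \<Rightarrow> 'o) \<Rightarrow> ('o \<Rightarrow> 'o \<Rightarrow> 'o \<Rightarrow> 'm \<Rightarrow> 'm \<Rightarrow> 's) \<Rightarrow> ('o, 'm) proxy_op
      \<Rightarrow> ('s, 'm) proxy_op" where
  "pullback_proxy f Z P A X Y x y =
     \<lparr>tip = Z (f A) (f X) (f Y) x y,
      left_leg = left_leg (P (f A) (f X) (f Y) x y),
      right_leg = right_leg (P (f A) (f X) (f Y) x y)\<rparr>"

lemma pullback_proxy_simps [simp]:
  "tip (pullback_proxy f Z P A X Y x y) = Z (f A) (f X) (f Y) x y"
  "left_leg (pullback_proxy f Z P A X Y x y) = left_leg (P (f A) (f X) (f Y) x y)"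
  "right_leg (pullback_proxy f Z P A X Y x y) = right_leg (P (f A) (f X) (f Y) x y)"
  by (simp_all add: pullback_proxy_def)

text \<open>Separates the construction from the choice of preimages of the spine, which enters here
  as the parameter \<open>\<Omega>S\<close>.\<close>

locale spined_pullback = spined_category C \<Omega> P
  for C :: "('o, 'm) cat" and \<Omega> P +
  fixes S :: "'s set"
    and f :: "'s \<Rightarrow> 'o"
    and \<Omega>S :: "nat \<Rightarrow> 's"
    and Z :: "'o \<Rightarrow> 'o \<Rightarrow> 'o \<Rightarrow> 'm \<Rightarrow> 'm \<Rightarrow> 's"
  assumes obj_image: "f ` S \<subseteq> Obj C"
    and spine_mem: "\<Omega>S n \<in> S"
    and spine_image [simp]: "f (\<Omega>S n) = \<Omega> n"
    and tip_lift: "\<lbrakk>X \<in> S; Y \<in> S; x \<in> Hom C (\<Omega> n) (f X); y \<in> Hom C (\<Omega> n) (f Y)\<rbrakk>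
           \<Longrightarrow> Z (\<Omega> n) (f X) (f Y) x y \<in> S \<and>
               f (Z (\<Omega> n) (f X) (f Y) x y) = tip (P (\<Omega> n) (f X) (f Y) x y)"
begin

text \<open>As \<open>\<Omega>S n\<close> lies over \<open>\<Omega> n\<close>, spans in the pullback
  are spans in \<open>C\<close> between images. The facts about \<open>Z\<close> then let each axiom
  be read in \<open>C\<close>.\<close>

lemma spine_span_lift:
  assumes "spine_span (pullback_cat S f C) \<Omega>S n X Y x y"
  shows "spine_span C \<Omega> n (f X) (f Y) x y"
    and "Z (\<Omega> n) (f X) (f Y) x y \<in> S"
    and "f (Z (\<Omega> n) (f X) (f Y) x y) = tip (P (\<Omega> n) (f X) (f Y) x y)"
  using assms obj_image tip_lift by (auto simp: spine_span_def)

lemma spined_category_pullback: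
  "spined_category (pullback_cat S f C) \<Omega>S (pullback_proxy f Z P)"
proof -
  let ?S = "pullback_cat S f C"
  interpret S: category ?S
    using category_axioms obj_image by (rule category_pullback_cat)
  have obj: "f A \<in> Obj C" if "A \<in> S" for A
    using obj_image that by blast
  show ?thesis
  proof (unfold_locales, goal_cases)
    \<comment> \<open>This case is \<open>SC2\<close>, the only axiom mentioning two proxy pushouts,
      so the tip of the composite span has to be identified as well.\<close>
    case (7 n G H g h G' H' g' h')
    note span = spine_span_lift[OF 7(1)]
    have G': "G' \<in> S" "f G' \<in> Obj C" and H': "H' \<in> S" "f H' \<in> Obj C"
      and g': "g' \<in> Hom C (f G) (f G')" and h': "h' \<in> Hom C (f H) (f H')"
      using 7 obj by simp_all
    have "spine_span C \<Omega> n (f G') (f H')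
        (Comp C (\<Omega> n) (f G) (f G') g' g) (Comp C (\<Omega> n) (f H) (f H') h' h)"
      using span(1) G'(2) H'(2) g' h' by (rule spine_span_comp)
    then have "f (Z (\<Omega> n) (f G') (f H')
          (Comp C (\<Omega> n) (f G) (f G') g' g) (Comp C (\<Omega> n) (f H) (f H') h' h))
        = tip (P (\<Omega> n) (f G') (f H')
          (Comp C (\<Omega> n) (f G) (f G') g' g) (Comp C (\<Omega> n) (f H) (f H') h' h))"
      using G'(1) H'(1) tip_lift by (simp add: spine_span_def)
    \<comment> \<open>Both tips now lie over the corresponding tips in \<open>C\<close>, so
      candidates for the mediating morphism and the equations on them are the same in both
      categories, and unique existence transfers.\<close>
    then show ?case
      using SC2[OF span(1) G'(2) H'(2) g' h'] span(3) by (simp add: Let_def)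
  qed (simp_all add: spine_mem spine_span_lift left_leg_hom right_leg_hom proxy_commutes
      SC1 obj)
qed

lemma spinal_functor_pullback:
  "spinal_functor (pullback_cat S f C) \<Omega>S (pullback_proxy f Z P) C \<Omega> P f (\<lambda>A B m. m)"
proof -
  interpret S: spined_category "pullback_cat S f C" \<Omega>S "pullback_proxy f Z P"
    by (rule spined_category_pullback)
  interpret f: category_functor "pullback_cat S f C" C f "\<lambda>A B m. m"
    using category_axioms obj_image by (rule category_functor_pullback_cat)
  show ?thesis
    \<comment> \<open>Preservation of tips is the defining property of \<open>Z\<close>; that of
      legs holds by construction.\<close>
    by unfold_locales (simp_all add: spine_span_lift)
qed

end

theorem theorem6p1:
  fixes C :: "('o, 'm) cat"
    and \<Omega> :: "nat \<Rightarrow> 'o"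
    and P :: "('o, 'm) proxy_op"
    and S :: "'s set"
    and f :: "'s \<Rightarrow> 'o"
    and Z :: "'o \<Rightarrow> 'o \<Rightarrow> 'o \<Rightarrow> 'm \<Rightarrow> 'm \<Rightarrow> 's"
  assumes "spined_category C \<Omega> P"
    and "f ` S \<subseteq> Obj C"
    and "\<And>n. \<exists>X\<in>S. f X = \<Omega> n"
    and "\<And>n X Y x y. \<lbrakk>X \<in> S; Y \<in> S; x \<in> Hom C (\<Omega> n) (f X); y \<in> Hom C (\<Omega> n) (f Y)\<rbrakk>
           \<Longrightarrow> Z (\<Omega> n) (f X) (f Y) x y \<in> S \<and>
               f (Z (\<Omega> n) (f X) (f Y) x y) = tip (P (\<Omega> n) (f X) (f Y) x y)"
  shows "\<exists>\<Omega>S PS.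
           spined_category (pullback_cat S f C) \<Omega>S PS \<and>
           spinal_functor (pullback_cat S f C) \<Omega>S PS C \<Omega> P f (\<lambda>A B m. m) \<and>
           (measurable C \<Omega> P \<longrightarrow> measurable (pullback_cat S f C) \<Omega>S PS)"
proof -
  \<comment> \<open>Preimages of the spine are merely known to exist, so one is chosen for each
    \<open>n\<close>; the tips come with the distinguished lifts \<open>Z\<close>.\<close>
  obtain \<Omega>S where \<Omega>S: "\<And>n. \<Omega>S n \<in> S" "\<And>n. f (\<Omega>S n) = \<Omega> n"
    using assms(3) by metis
  interpret spined_pullback C \<Omega> P S f \<Omega>S Z
    using assms(1,2,4) \<Omega>S by (simp add: spined_pullback_def spined_pullback_axioms_def)
  show ?thesis
    using spined_category_pullback spinal_functor_pullback
      measurable_spinal_functor[OF spinal_functor_pullback] by blast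
qed

end
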